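(* Let $m,n$ be positive integers and let $\phi:M_{mn}\to M_{mn}$ be a linear map. Then $\operatorname{tr}\phi(A\oplus B)=\operatorname{tr}(A\oplus B)$ for all $A\in M_m$ and $B\in M_n$ if and only if $$\operatorname{tr}_1\phi'(I_{mn})=\operatorname{tr}_1(I_{mn})\quad\text{and}\quad \operatorname{tr}_2\phi'(I_{mn})=\operatorname{tr}_2(I_{mn}).$$
   Context: $\mathbb{F}=\mathbb{R}$ or $\mathbb{F}=\mathbb{C}$. $M_k$ denotes the algebra of $k\times k$ matrices over $\mathbb{F}$, $I_k$ is the $k\times k$ identity matrix, and $E_{ij}^{(k)}$ is the $k\times k$ matrix with $(i,j)$ entry $1$ and all other entries $0$. $M_{mn}$ is identified with $M_m\otimes M_n=M_m(M_n)$ via the Kronecker product $\otimes$, so $A\in M_{mn}$ is an $m\times m$ block matrix $A=(A_{ij})_{i,j=1}^m$ with blocks $A_{ij}\in M_n$. The Kronecker sum of $A\in M_m$ and $B\in M_n$ is $A\oplus B:=A\otimes I_n+I_m\otimes B\in M_{mn}$ (not the direct sum). The partial traces are the linear maps $\operatorname{tr}_1:M_{mn}\to M_n$, $\operatorname{tr}_1(A)=\sum_{j=1}^m A_{jj}$, and $\operatorname{tr}_2:M_{mn}\to M_m$, $\operatorname{tr}_2(A)=(\operatorname{tr}(A_{ij}))_{i,j=1}^m$. Every linear map $\phi:M_N\to M_N$ can be written uniquely as $\phi(A)=\sum_{j,k,u,v=1}^N \alpha_{jk;uv}E_{jk}^{(N)}AE_{uv}^{(N)}$ with $\alpha_{jk;uv}\in\mathbb{F}$.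 The linear map $\phi':M_N\to M_N$ is then defined by $\phi'(A):=\sum_{j,k,u,v=1}^N \alpha_{jk;uv}E_{uv}^{(N)}AE_{jk}^{(N)}$. Here this is applied with $N=mn$. *)

theory Defs
  imports "HOL-Analysis.Analysis"
begin

text \<open>
  A square matrix of size \<open>k\<close> is a term of type \<open>'a^'k^'k\<close> with \<open>CARD('k) = k\<close>.  Matrices of size
  \<open>m * n\<close> are indexed by the product type \<open>'m \<times> 'n\<close>, the first component being the index of the
  block and the second one the index inside a block; this is the identification of \<open>M\<^sub>m\<^sub>n\<close> with
  \<open>M\<^sub>m(M\<^sub>n)\<close> given by the Kronecker product.
\<close>

text \<open>
  The library has no scalar multiplication of matrices over an arbitrary field: the
  operation \<open>*\<^sub>R\<close> only gives real scalars, which is not enough for complex-linear maps.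
\<close>

definition mat_scale :: "'a::field \<Rightarrow> 'a^'c^'r \<Rightarrow> 'a^'c^'r"  (infixr "*\<^sub>M" 75)
  where "c *\<^sub>M A = (\<chi> i j. c * A $ i $ j)"

definition mat_unit :: "'k \<Rightarrow> 'k \<Rightarrow> 'a::field^'k^'k"
  where "mat_unit i j = (\<chi> a b. if a = i \<and> b = j then 1 else 0)"

definition block :: "'a^('m::finite \<times> 'n::finite)^('m \<times> 'n) \<Rightarrow> 'm \<Rightarrow> 'm \<Rightarrow> 'a^'n^'n"
  where "block A i j = (\<chi> k l. A $ (i, k) $ (j, l))"

definition kron :: "'a::field^'m^'m \<Rightarrow> 'a^'n^'n \<Rightarrow> 'a^('m::finite \<times> 'n::finite)^('m \<times> 'n)"  (infixr "\<otimes>\<^sub>K" 70)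
  where "A \<otimes>\<^sub>K B = (\<chi> p q. A $ fst p $ fst q * B $ snd p $ snd q)"

definition kron_sum :: "'a::field^'m^'m \<Rightarrow> 'a^'n^'n \<Rightarrow> 'a^('m::finite \<times> 'n::finite)^('m \<times> 'n)"  (infixr "\<oplus>\<^sub>K" 65)
  where "A \<oplus>\<^sub>K B = A \<otimes>\<^sub>K mat 1 + mat 1 \<otimes>\<^sub>K B"

definition ptrace1 :: "'a::field^('m::finite \<times> 'n)^('m \<times> 'n) \<Rightarrow> 'a^'n^'n"
  where "ptrace1 A = (\<Sum>j\<in>UNIV. block A j j)"

definition ptrace2 :: "'a::field^('m::finite \<times> 'n::finite)^('m \<times> 'n) \<Rightarrow> 'a^'m^'m"
  where "ptrace2 A = (\<chi> i j. trace (block A i j))"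

definition elem_coeffs ::
    "('a::field^'k^'k \<Rightarrow> 'a^'k^'k) \<Rightarrow> 'k::finite \<Rightarrow> 'k \<Rightarrow> 'k \<Rightarrow> 'k \<Rightarrow> 'a"
  where "elem_coeffs \<phi> = (THE \<alpha>. \<forall>A. \<phi> A =
    (\<Sum>j\<in>UNIV. \<Sum>k\<in>UNIV. \<Sum>u\<in>UNIV. \<Sum>v\<in>UNIV.
       \<alpha> j k u v *\<^sub>M (mat_unit j k ** A ** mat_unit u v)))"

definition flip_map :: "('a::field^'k^'k \<Rightarrow> 'a^'k^'k) \<Rightarrow> 'a^'k^'k \<Rightarrow> 'a^'k::finite^'k"
  where "flip_map \<phi> A =
    (\<Sum>j\<in>UNIV. \<Sum>k\<in>UNIV. \<Sum>u\<in>UNIV. \<Sum>v\<in>UNIV.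
       elem_coeffs \<phi> j k u v *\<^sub>M (mat_unit u v ** A ** mat_unit j k))"

lemma block_kron: "block (A \<otimes>\<^sub>K B) i j = (A $ i $ j) *\<^sub>M B"
  by (simp add: block_def kron_def mat_scale_def)

lemma vector_space_mat_scale: "vector_space (mat_scale :: 'a::field \<Rightarrow> 'a^'c^'r \<Rightarrow> 'a^'c^'r)"
  by unfold_locales (simp_all add: mat_scale_def vec_eq_iff algebra_simps)

text \<open>
  For linear maps the coefficients exist and are unique, so the definite description
  in \<open>elem_coeffs\<close> denotes.
\<close>

lemma elem_sum_entry:
  fixes A :: "'a::field^'k::finite^'k"
  shows "(\<Sum>j\<in>UNIV. \<Sum>k\<in>UNIV. \<Sum>u\<in>UNIV. \<Sum>v\<in>UNIV.
       \<alpha> j k u v *\<^sub>M (mat_unit j k ** A ** mat_unit u v)) $ a $ b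
     = (\<Sum>k\<in>UNIV. \<Sum>u\<in>UNIV. \<alpha> a k u b * A $ k $ u)"
proof -
  have sw: "(\<alpha> j k u v *\<^sub>M (mat_unit j k ** A ** mat_unit u v)) $ a $ b
     = (if j = a then if v = b then \<alpha> j k u v * A $ k $ u else 0 else 0)" for j k u v
    by (auto simp: mat_scale_def matrix_matrix_mult_def mat_unit_def
        if_distrib[of "\<lambda>x. x * _"] if_distrib[of "(*) _"] sum.delta
        simp flip: if_if_eq_conj cong: if_cong)
  have pull: "(\<Sum>k\<in>UNIV. \<Sum>u\<in>UNIV. if j = a then f k u else 0)
     = (if j = a then \<Sum>k\<in>UNIV. \<Sum>u\<in>UNIV. f k u else 0)" for j and f :: "'k \<Rightarrow> 'k \<Rightarrow> 'a"
    by auto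
  have inner: "(\<Sum>v\<in>UNIV. if j = a then if v = b then g v else 0 else 0)
     = (if j = a then g b else 0)" for j and g :: "'k \<Rightarrow> 'a"
    by auto
  show ?thesis
    unfolding sum_component sw inner pull by simp
qed

lemma elem_coeffs_ex1:
  fixes \<phi> :: "'a::field^'k::finite^'k \<Rightarrow> 'a^'k^'k"
  assumes "Vector_Spaces.linear mat_scale mat_scale \<phi>"
  shows "\<exists>!\<alpha>. \<forall>A. \<phi> A =
    (\<Sum>j\<in>UNIV. \<Sum>k\<in>UNIV. \<Sum>u\<in>UNIV. \<Sum>v\<in>UNIV.
       \<alpha> j k u v *\<^sub>M (mat_unit j k ** A ** mat_unit u v))"
proof -
  interpret Vector_Spaces.linear mat_scale mat_scale \<phi> by fact
  have expand: "A = (\<Sum>k\<in>UNIV. \<Sum>u\<in>UNIV. (A $ k $ u) *\<^sub>M mat_unit k u)" for A :: "'a^'k^'k"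
  proof -
    have "(\<Sum>k\<in>UNIV. \<Sum>u\<in>UNIV. ((A $ k $ u) *\<^sub>M mat_unit k u) $ a $ b) = A $ a $ b" for a b
    proof -
      have "(\<Sum>k\<in>UNIV. \<Sum>u\<in>UNIV. ((A $ k $ u) *\<^sub>M mat_unit k u) $ a $ b)
        = (\<Sum>k\<in>UNIV. if k = a then (\<Sum>u\<in>UNIV. if u = b then A $ k $ u else 0) else 0)"
        by (intro sum.cong) (auto simp: mat_scale_def mat_unit_def if_distrib[of "(*) _"] cong: if_cong)
      then show ?thesis by simp
    qed
    then show ?thesis by (simp add: vec_eq_iff)
  qed
  show ?thesis
  proof (rule ex1I[of _ "\<lambda>j k u v. \<phi> (mat_unit k u) $ j $ v"], intro allI)
    fix A
    have "\<phi> A = (\<Sum>k\<in>UNIV. \<Sum>u\<in>UNIV. (A $ k $ u) *\<^sub>M \<phi> (mat_unit k u))"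
      by (subst expand[of A]) (simp add: sum scale)
    then show "\<phi> A = (\<Sum>j\<in>UNIV. \<Sum>k\<in>UNIV. \<Sum>u\<in>UNIV. \<Sum>v\<in>UNIV.
       \<phi> (mat_unit k u) $ j $ v *\<^sub>M (mat_unit j k ** A ** mat_unit u v))"
      unfolding vec_eq_iff elem_sum_entry by (simp add: mat_scale_def mult.commute)
  next
    fix \<alpha> assume *: "\<forall>A. \<phi> A = (\<Sum>j\<in>UNIV. \<Sum>k\<in>UNIV. \<Sum>u\<in>UNIV. \<Sum>v\<in>UNIV.
       \<alpha> j k u v *\<^sub>M (mat_unit j k ** A ** mat_unit u v))"
    have "\<alpha> j k u v = \<phi> (mat_unit k u) $ j $ v" for j k u v
    proof -
      have "\<phi> (mat_unit k u) $ j $ v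
        = (\<Sum>k'\<in>UNIV. \<Sum>u'\<in>UNIV. \<alpha> j k' u' v * (mat_unit k u :: 'a^'k^'k) $ k' $ u')"
        by (subst *[rule_format]) (rule elem_sum_entry)
      also have "\<dots> = (\<Sum>k'\<in>UNIV. if k' = k
          then (\<Sum>u'\<in>UNIV. if u' = u then \<alpha> j k' u' v else 0) else 0)"
        by (intro sum.cong) (auto simp: mat_unit_def if_distrib[of "(*) _"] cong: if_cong)
      finally show ?thesis by simp
    qed
    then show "\<alpha> = (\<lambda>j k u v. \<phi> (mat_unit k u) $ j $ v)" by (intro ext)
  qed
qed

end

theory Submission
  imports Defs
begin

text \<open>
  The map \<open>\<phi>'\<close> is the adjoint of \<open>\<phi>\<close> for the bilinear form \<open>tr (X Y)\<close>, so
  \<open>tr (\<phi> X) = tr (\<phi>' I X)\<close>.  The partial traces are adjoint to the embeddings \<open>A \<mapsto> A \<otimes> I\<close> and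
  \<open>B \<mapsto> I \<otimes> B\<close>, whence \<open>tr (C (A \<oplus> B)) = tr (tr\<^sub>2 C A) + tr (tr\<^sub>1 C B)\<close>.  Taking
  \<open>C = \<phi>' I\<close> and \<open>C = I\<close>, the claim follows from the nondegeneracy of the form.
\<close>

lemma trace_matrix_mult:
  fixes C D :: "'a::comm_semiring_1^'k^'k"
  shows "trace (C ** D) = (\<Sum>i\<in>UNIV. \<Sum>j\<in>UNIV. C $ i $ j * D $ j $ i)"
  by (simp add: trace_def matrix_matrix_mult_def)

lemma trace_matrix_mult_mat_unit:
  fixes C :: "'a::field^'k^'k"
  shows "trace (C ** mat_unit j i) = C $ i $ j"
proof -
  \<comment> \<open>The conjunction in \<open>mat_unit\<close> is split into nested conditionals, so
    that each one collapses a single sum.\<close>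
  have "trace (C ** mat_unit j i)
    = (\<Sum>a\<in>UNIV. if a = i then (\<Sum>b\<in>UNIV. if b = j then C $ a $ b else 0) else 0)"
    unfolding trace_matrix_mult
    by (intro sum.cong) (auto simp: mat_unit_def if_distrib[of "(*) _"] cong: if_cong)
  then show ?thesis by simp
qed

text \<open>Nondegeneracy of the trace form: matrix units as test matrices read off every
  entry.\<close>

lemma trace_matrix_mult_eq_iff:
  fixes C D :: "'a::field^'k^'k"
  shows "(\<forall>A. trace (C ** A) = trace (D ** A)) \<longleftrightarrow> C = D"
  by (metis trace_matrix_mult_mat_unit vec_eq_iff)

lemma flip_map_entry:
  fixes \<phi> :: "'a::field^'k::finite^'k \<Rightarrow> 'a^'k^'k"
  shows "flip_map \<phi> A $ a $ b = (\<Sum>v\<in>UNIV. \<Sum>j\<in>UNIV. elem_coeffs \<phi> j b a v * A $ v $ j)"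
proof -
  let ?f = "\<lambda>j k u v. elem_coeffs \<phi> j k u v *\<^sub>M (mat_unit u v ** A ** mat_unit j k)"
  \<comment> \<open>Move k innermost, then j past u and v. The order u, v, j, k makes this an
    elementary sum whose index pairs have changed places, as \<open>elem_sum_entry\<close>
    requires.\<close>
  have "flip_map \<phi> A = (\<Sum>j\<in>UNIV. \<Sum>u\<in>UNIV. \<Sum>v\<in>UNIV. \<Sum>k\<in>UNIV. ?f j k u v)"
    unfolding flip_map_def
    by (rule sum.cong[OF refl], rule trans[OF sum.swap], rule sum.cong[OF refl], rule sum.swap)
  also have "\<dots> = (\<Sum>u\<in>UNIV. \<Sum>v\<in>UNIV. \<Sum>j\<in>UNIV. \<Sum>k\<in>UNIV. ?f j k u v)"
    by (rule trans[OF sum.swap], rule sum.cong[OF refl], rule sum.swap)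
  finally show ?thesis
    using elem_sum_entry[of "\<lambda>u v j k. elem_coeffs \<phi> j k u v" A a b] by simp
qed

text \<open>The trace identifies the outer indices j and v, so X $ k $ u gets the coefficient
  \<Sum>j. \<alpha> j k u j. This is the (u, k) entry of \<phi>' at the identity.\<close>

lemma trace_linear_eq_flip_map:
  fixes \<phi> :: "'a::field^'k::finite^'k \<Rightarrow> 'a^'k^'k"
  assumes "Vector_Spaces.linear mat_scale mat_scale \<phi>"
  shows "trace (\<phi> X) = trace (flip_map \<phi> (mat 1) ** X)"
proof -
  let ?\<alpha> = "elem_coeffs \<phi>"
  have "\<phi> X = (\<Sum>j\<in>UNIV. \<Sum>k\<in>UNIV. \<Sum>u\<in>UNIV. \<Sum>v\<in>UNIV.
       ?\<alpha> j k u v *\<^sub>M (mat_unit j k ** X ** mat_unit u v))"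
    \<comment> \<open>Linearity enters here: it makes the definite description in
      \<open>elem_coeffs\<close> denote.\<close>
    using theI'[OF elem_coeffs_ex1[OF assms]] unfolding elem_coeffs_def by blast
  then have "trace (\<phi> X) = (\<Sum>j\<in>UNIV. \<Sum>k\<in>UNIV. \<Sum>u\<in>UNIV. ?\<alpha> j k u j * X $ k $ u)"
    by (simp only: trace_def elem_sum_entry)
  also have "\<dots> = (\<Sum>u\<in>UNIV. \<Sum>k\<in>UNIV. \<Sum>j\<in>UNIV. ?\<alpha> j k u j * X $ k $ u)"
    by (subst sum.swap, subst (2) sum.swap, subst sum.swap, rule refl)
  also have "\<dots> = trace (flip_map \<phi> (mat 1) ** X)"
    by (simp add: trace_matrix_mult flip_map_entry mat_def sum_distrib_right
        if_distrib[of "(*) _"] cong: if_cong)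
  finally show ?thesis .
qed

lemma sum_UNIV_prod:
  fixes f :: "'m::finite \<times> 'n::finite \<Rightarrow> 'a::comm_monoid_add"
  shows "(\<Sum>p\<in>UNIV. f p) = (\<Sum>i\<in>UNIV. \<Sum>k\<in>UNIV. f (i, k))"
  by (simp add: sum.cartesian_product)

text \<open>The identity factor forces equal indices inside the blocks; summing over them gives the
  traces of the blocks of C.\<close>

lemma trace_matrix_mult_kron_mat_1:
  fixes C :: "'a::field^('m::finite \<times> 'n::finite)^('m \<times> 'n)"
  shows "trace (C ** (A \<otimes>\<^sub>K mat 1)) = trace (ptrace2 C ** A)"
proof -
  have "trace (C ** (A \<otimes>\<^sub>K mat 1))
    = (\<Sum>i\<in>UNIV. \<Sum>k\<in>UNIV. \<Sum>j\<in>UNIV. C $ (i, k) $ (j, k) * A $ j $ i)"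
    by (simp add: trace_matrix_mult sum_UNIV_prod kron_def mat_def
        if_distrib[of "(*) _"] cong: if_cong)
  also have "\<dots> = (\<Sum>i\<in>UNIV. \<Sum>j\<in>UNIV. \<Sum>k\<in>UNIV. C $ (i, k) $ (j, k) * A $ j $ i)"
    by (intro sum.cong refl, rule sum.swap)
  also have "\<dots> = trace (ptrace2 C ** A)"
    unfolding trace_matrix_mult by (simp add: ptrace2_def block_def trace_def sum_distrib_right)
  finally show ?thesis .
qed

text \<open>Here the identity factor forces equal block indices, so only the diagonal blocks of C
  contribute.\<close>

lemma trace_matrix_mult_mat_1_kron:
  fixes C :: "'a::field^('m::finite \<times> 'n::finite)^('m \<times> 'n)"
  shows "trace (C ** (mat 1 \<otimes>\<^sub>K B)) = trace (ptrace1 C ** B)"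
proof -
  \<comment> \<open>The condition concerns the outer variable j; swapping the sums brings it to the
    inner one, where it collapses.\<close>
  have inner: "(\<Sum>j\<in>UNIV. \<Sum>l\<in>UNIV. if j = i then f j l else 0) = (\<Sum>l\<in>UNIV. f i l)"
    for i :: 'm and f :: "'m \<Rightarrow> 'n \<Rightarrow> 'a"
    by (subst sum.swap) simp
  have "trace (C ** (mat 1 \<otimes>\<^sub>K B))
    = (\<Sum>i\<in>UNIV. \<Sum>k\<in>UNIV. \<Sum>l\<in>UNIV. C $ (i, k) $ (i, l) * B $ l $ k)"
    by (simp add: trace_matrix_mult sum_UNIV_prod kron_def mat_def inner
        if_distrib[of "(*) _"] if_distrib[of "\<lambda>x. x * _"] cong: if_cong)
  also have "\<dots> = (\<Sum>k\<in>UNIV. \<Sum>l\<in>UNIV. \<Sum>i\<in>UNIV. C $ (i, k) $ (i, l) * B $ l $ k)"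
    by (subst sum.swap, intro sum.cong refl, rule sum.swap)
  also have "\<dots> = trace (ptrace1 C ** B)"
    by (simp add: trace_matrix_mult ptrace1_def block_def sum_distrib_right)
  finally show ?thesis .
qed

lemma trace_matrix_mult_kron_sum:
  fixes C :: "'a::field^('m::finite \<times> 'n::finite)^('m \<times> 'n)"
  shows "trace (C ** (A \<oplus>\<^sub>K B)) = trace (ptrace2 C ** A) + trace (ptrace1 C ** B)"
  by (simp add: kron_sum_def matrix_add_ldistrib trace_add
      trace_matrix_mult_kron_mat_1 trace_matrix_mult_mat_1_kron)

text \<open>Since A and B vary independently, setting one of them to 0 isolates the partial trace
  paired with the other.\<close>

lemma trace_matrix_mult_kron_sum_eq_iff:
  fixes C D :: "'a::field^('m::finite \<times> 'n::finite)^('m \<times> 'n)"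
  shows "(\<forall>A B. trace (C ** (A \<oplus>\<^sub>K B)) = trace (D ** (A \<oplus>\<^sub>K B)))
    \<longleftrightarrow> ptrace1 C = ptrace1 D \<and> ptrace2 C = ptrace2 D"
    (is "?L \<longleftrightarrow> ?R")
proof
  assume L: ?L
  have zero: "trace (E ** 0) = 0" for E :: "'a^'k::finite^'k"
    by (simp add: trace_def matrix_matrix_mult_def)
  have "trace (ptrace1 C ** B) = trace (ptrace1 D ** B)" for B
    using L[rule_format, of 0 B] by (simp add: trace_matrix_mult_kron_sum zero)
  moreover have "trace (ptrace2 C ** A) = trace (ptrace2 D ** A)" for A
    using L[rule_format, of A 0] by (simp add: trace_matrix_mult_kron_sum zero)
  ultimately show ?R
    by (simp flip: trace_matrix_mult_eq_iff)
qed (simp add: trace_matrix_mult_kron_sum)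

text \<open>The argument works over any field, so the real and complex cases are both
  instances.\<close>

lemma trace_preserving_on_kron_sum_iff:
  fixes \<phi> :: "'a::field^('m::finite \<times> 'n::finite)^('m \<times> 'n) \<Rightarrow> 'a^('m \<times> 'n)^('m \<times> 'n)"
  assumes "Vector_Spaces.linear mat_scale mat_scale \<phi>"
  shows "(\<forall>A B. trace (\<phi> (A \<oplus>\<^sub>K B)) = trace (A \<oplus>\<^sub>K B))
    \<longleftrightarrow> ptrace1 (flip_map \<phi> (mat 1)) = ptrace1 (mat 1 :: 'a^('m \<times> 'n)^('m \<times> 'n))
      \<and> ptrace2 (flip_map \<phi> (mat 1)) = ptrace2 (mat 1 :: 'a^('m \<times> 'n)^('m \<times> 'n))"
  using trace_matrix_mult_kron_sum_eq_iff[of "flip_map \<phi> (mat 1)" "mat 1"]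
  by (simp add: trace_linear_eq_flip_map[OF assms])

theorem theorem3p5:
  shows "(\<forall>\<phi> :: real^('m::finite \<times> 'n::finite)^('m \<times> 'n) \<Rightarrow> real^('m \<times> 'n)^('m \<times> 'n).
      Vector_Spaces.linear mat_scale mat_scale \<phi> \<longrightarrow>
      ((\<forall>(A :: real^'m^'m) (B :: real^'n^'n). trace (\<phi> (A \<oplus>\<^sub>K B)) = trace (A \<oplus>\<^sub>K B))
        \<longleftrightarrow> ptrace1 (flip_map \<phi> (mat 1)) = ptrace1 (mat 1 :: real^('m \<times> 'n)^('m \<times> 'n))
          \<and> ptrace2 (flip_map \<phi> (mat 1)) = ptrace2 (mat 1 :: real^('m \<times> 'n)^('m \<times> 'n))))
    \<and> (\<forall>\<phi> :: complex^('m \<times> 'n)^('m \<times> 'n) \<Rightarrow> complex^('m \<times> 'n)^('m \<times> 'n).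
      Vector_Spaces.linear mat_scale mat_scale \<phi> \<longrightarrow>
      ((\<forall>(A :: complex^'m^'m) (B :: complex^'n^'n). trace (\<phi> (A \<oplus>\<^sub>K B)) = trace (A \<oplus>\<^sub>K B))
        \<longleftrightarrow> ptrace1 (flip_map \<phi> (mat 1)) = ptrace1 (mat 1 :: complex^('m \<times> 'n)^('m \<times> 'n))
          \<and> ptrace2 (flip_map \<phi> (mat 1)) = ptrace2 (mat 1 :: complex^('m \<times> 'n)^('m \<times> 'n))))"
  by (intro conjI allI impI trace_preserving_on_kron_sum_iff)

end
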